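(* $\mathit{PA}$ is consistent; that is, there is no formula $\alpha$ such that both $\alpha$ and $\neg\alpha$ are theorems of $\mathit{PA}$.
   Context: $\mathit{PA}$ is a first-order theory adequately formalizing Peano Arithmetic (for example Mendelson's system $S$), with inference rules Modus Ponens and Generalization. *)

theory Defs
  imports Main
begin

(* Mendelson's first-order theory S, as a Hilbert system with Modus Ponens and
   Generalization.  Variables are named (Var n is the n-th variable), quantifiers bind
   names, and the primitive connectives are negation, implication and the universal
   quantifier. *)

datatype tm =
    Var nat
  | Zero
  | Succ tm
  | Add tm tm
  | Mul tm tm

datatype fm =
    Eq tm tm
  | Neg fm
  | Imp fm fm
  | All nat fm

primrec vars_tm :: "tm \<Rightarrow> nat set" where
  "vars_tm (Var y) = {y}"
| "vars_tm Zero = {}"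
| "vars_tm (Succ s) = vars_tm s"
| "vars_tm (Add s u) = vars_tm s \<union> vars_tm u"
| "vars_tm (Mul s u) = vars_tm s \<union> vars_tm u"

primrec free_vars :: "fm \<Rightarrow> nat set" where
  "free_vars (Eq s u) = vars_tm s \<union> vars_tm u"
| "free_vars (Neg A) = free_vars A"
| "free_vars (Imp A B) = free_vars A \<union> free_vars B"
| "free_vars (All y A) = free_vars A - {y}"

primrec subst_tm :: "tm \<Rightarrow> nat \<Rightarrow> tm \<Rightarrow> tm" where
  "subst_tm (Var y) x t = (if y = x then t else Var y)"
| "subst_tm Zero x t = Zero"
| "subst_tm (Succ s) x t = Succ (subst_tm s x t)"
| "subst_tm (Add s u) x t = Add (subst_tm s x t) (subst_tm u x t)"
| "subst_tm (Mul s u) x t = Mul (subst_tm s x t) (subst_tm u x t)"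

(* Literal replacement of the free occurrences of x by t: bound variables are not renamed,
   so variables of t may be captured; free_for below excludes this. *)
primrec subst :: "fm \<Rightarrow> nat \<Rightarrow> tm \<Rightarrow> fm" where
  "subst (Eq s u) x t = Eq (subst_tm s x t) (subst_tm u x t)"
| "subst (Neg A) x t = Neg (subst A x t)"
| "subst (Imp A B) x t = Imp (subst A x t) (subst B x t)"
| "subst (All y A) x t = (if y = x then All y A else All y (subst A x t))"

(* No free occurrence of x in the formula lies in the scope of a quantifier over a
   variable of t. *)
primrec free_for :: "tm \<Rightarrow> nat \<Rightarrow> fm \<Rightarrow> bool" where
  "free_for t x (Eq s u) = True"
| "free_for t x (Neg A) = free_for t x A"
| "free_for t x (Imp A B) = (free_for t x A \<and> free_for t x B)"
| "free_for t x (All y A) =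
     (x \<notin> free_vars (All y A) \<or> (y \<notin> vars_tm t \<and> free_for t x A))"

inductive derivable :: "fm set \<Rightarrow> fm \<Rightarrow> bool" (infix "\<turnstile>" 50)
  for T :: "fm set" where
  A1: "T \<turnstile> Imp A (Imp B A)"
| A2: "T \<turnstile> Imp (Imp A (Imp B C)) (Imp (Imp A B) (Imp A C))"
| A3: "T \<turnstile> Imp (Imp (Neg B) (Neg A)) (Imp (Imp (Neg B) A) B)"
| A4: "free_for t x A \<Longrightarrow> T \<turnstile> Imp (All x A) (subst A x t)"
| A5: "x \<notin> free_vars A \<Longrightarrow> T \<turnstile> Imp (All x (Imp A B)) (Imp A (All x B))"
| Ax: "A \<in> T \<Longrightarrow> T \<turnstile> A"
| MP: "T \<turnstile> A \<Longrightarrow> T \<turnstile> Imp A B \<Longrightarrow> T \<turnstile> B"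
| Gen: "T \<turnstile> A \<Longrightarrow> T \<turnstile> All x A"

(* S1-S8 are single formulas in specific variables, from which all instances follow by
   Gen and A4.  Reflexivity and the remaining laws of equality are derivable.  In S9 the
   formula A may have free variables other than x, and the term Succ (Var x) is always free for x
   in A, so no side condition is needed. *)
inductive_set PA :: "fm set" where
  S1: "Imp (Eq (Var 1) (Var 2)) (Imp (Eq (Var 1) (Var 3)) (Eq (Var 2) (Var 3))) \<in> PA"
| S2: "Imp (Eq (Var 1) (Var 2)) (Eq (Succ (Var 1)) (Succ (Var 2))) \<in> PA"
| S3: "Neg (Eq Zero (Succ (Var 1))) \<in> PA"
| S4: "Imp (Eq (Succ (Var 1)) (Succ (Var 2))) (Eq (Var 1) (Var 2)) \<in> PA"
| S5: "Eq (Add (Var 1) Zero) (Var 1) \<in> PA"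
| S6: "Eq (Add (Var 1) (Succ (Var 2))) (Succ (Add (Var 1) (Var 2))) \<in> PA"
| S7: "Eq (Mul (Var 1) Zero) Zero \<in> PA"
| S8: "Eq (Mul (Var 1) (Succ (Var 2))) (Add (Mul (Var 1) (Var 2)) (Var 1)) \<in> PA"
| S9: "Imp (subst A x Zero)
         (Imp (All x (Imp A (subst A x (Succ (Var x))))) (All x A)) \<in> PA"

end

theory Submission imports Defs begin

text \<open>Consistency follows from soundness with respect to the standard model. Interpret terms in the
natural numbers and formulas by Tarski's truth definition, relative to an environment that assigns
a number to each variable. Every theorem of \<open>PA\<close> is then true in all environments
(\<open>PA_sound\<close>), and no environment makes both \<open>\<alpha>\<close> and \<open>\<not>\<alpha>\<close> true.

The only delicate points in soundness are the axioms that mention substitution, namely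
universal instantiation and induction. Substitution is literal replacement, so it commutes with
evaluation only if no variable of the substituted term is captured (\<open>sat_subst\<close>). Given this,
the induction schema holds because induction holds for the natural numbers of the
metatheory, applied to the set of numbers that satisfy the formula.\<close>

primrec val :: "(nat \<Rightarrow> nat) \<Rightarrow> tm \<Rightarrow> nat" where
  "val e (Var y) = e y"
| "val e Zero = 0"
| "val e (Succ s) = Suc (val e s)"
| "val e (Add s u) = val e s + val e u"
| "val e (Mul s u) = val e s * val e u"

primrec sat :: "(nat \<Rightarrow> nat) \<Rightarrow> fm \<Rightarrow> bool" where
  "sat e (Eq s u) \<longleftrightarrow> val e s = val e u"
| "sat e (Neg A) \<longleftrightarrow> \<not> sat e A"
| "sat e (Imp A B) \<longleftrightarrow> (sat e A \<longrightarrow> sat e B)"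
| "sat e (All y A) \<longleftrightarrow> (\<forall>n. sat (e(y := n)) A)"

lemma val_cong: "(\<And>y. y \<in> vars_tm s \<Longrightarrow> e y = e' y) \<Longrightarrow> val e s = val e' s"
  by (induction s) auto

lemma sat_cong: "(\<And>y. y \<in> free_vars A \<Longrightarrow> e y = e' y) \<Longrightarrow> sat e A \<longleftrightarrow> sat e' A"
proof (induction A arbitrary: e e')
  case (Eq s u)
  then show ?case
    using val_cong[of s e e'] val_cong[of u e e'] by simp
next
  case (Neg A)
  then show ?case by (metis free_vars.simps(2) sat.simps(2))
next
  case (Imp A B)
  then show ?case by (metis UnI1 UnI2 free_vars.simps(3) sat.simps(3))
next
  case (All y A)
  have "sat (e(y := n)) A \<longleftrightarrow> sat (e'(y := n)) A" for n
    by (rule All.IH) (use All.prems in auto)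
  then show ?case by simp
qed

lemma val_fresh_update: "y \<notin> vars_tm t \<Longrightarrow> val (e(y := n)) t = val e t"
  by (rule val_cong) auto

lemma sat_fresh_update: "x \<notin> free_vars A \<Longrightarrow> sat (e(x := n)) A \<longleftrightarrow> sat e A"
  by (rule sat_cong) auto

lemma subst_tm_fresh: "x \<notin> vars_tm s \<Longrightarrow> subst_tm s x t = s"
  by (induction s) auto

lemma subst_fresh: "x \<notin> free_vars A \<Longrightarrow> subst A x t = A"
  by (induction A) (auto simp: subst_tm_fresh)

lemma val_subst_tm: "val e (subst_tm s x t) = val (e(x := val e t)) s"
  by (induction s) auto

text \<open>Below a quantifier over \<open>y\<close>, the term \<open>t\<close> is evaluated in an environment in which \<open>y\<close> has been
reassigned. Since \<open>free_for\<close> keeps \<open>y\<close> out of \<open>t\<close>, the value of \<open>t\<close> does not change. If instead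
\<open>x\<close> does not occur free below the quantifier, \<open>free_for\<close> says nothing about the body; then
there is nothing to replace and the value of \<open>x\<close> is irrelevant.\<close>

lemma sat_subst: "free_for t x A \<Longrightarrow> sat e (subst A x t) \<longleftrightarrow> sat (e(x := val e t)) A"
proof (induction A arbitrary: e)
  case (All y A)
  show ?case
  proof (cases "x \<in> free_vars (All y A)")
    case False
    then show ?thesis
      by (simp only: subst_fresh sat_fresh_update not_False_eq_True)
  next
    case True
    then have "y \<noteq> x" and "y \<notin> vars_tm t" and "free_for t x A"
      using All.prems by auto
    have "sat (e(y := n)) (subst A x t) \<longleftrightarrow> sat (e(x := val e t, y := n)) A" for n
      using All.IH[OF \<open>free_for t x A\<close>, of "e(y := n)"]
      by (simp only: val_fresh_update[OF \<open>y \<notin> vars_tm t\<close>] fun_upd_twist[OF \<open>y \<noteq> x\<close>])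
    then show ?thesis
      using \<open>y \<noteq> x\<close> by (simp only: subst.simps sat.simps if_False)
  qed
qed (auto simp: val_subst_tm)

text \<open>A quantifier over \<open>x\<close>, the only variable that could be captured, leaves no free occurrence of
\<open>x\<close> below it. This is what makes the successor substitution in the induction schema harmless.\<close>

lemma free_for_Succ_Var: "free_for (Succ (Var x)) x A"
  by (induction A) auto

lemma free_for_Zero: "free_for Zero x A"
  by (induction A) auto

lemma sat_induction_axiom:
  "sat e (Imp (subst A x Zero) (Imp (All x (Imp A (subst A x (Succ (Var x))))) (All x A)))"
proof -
  have "sat (e(x := n)) A"
    if zero: "sat (e(x := 0)) A"
      and step: "\<And>n. sat (e(x := n)) A \<Longrightarrow> sat (e(x := Suc n)) A" for n
    by (induction n) (fact zero, rule step)
  then show ?thesis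
    by (simp add: sat_subst free_for_Zero free_for_Succ_Var)
qed

lemma PA_axiom_true: "A \<in> PA \<Longrightarrow> sat e A"
proof (induction rule: PA.induct)
  case (S9 A x)
  show ?case by (rule sat_induction_axiom)
qed auto

text \<open>Truth has to be claimed for all environments at once: Generalization does not preserve truth
in a single environment.\<close>

lemma derivable_sound:
  assumes "T \<turnstile> A" and axioms_true: "\<And>B e. B \<in> T \<Longrightarrow> sat e B"
  shows "sat e A"
  using assms(1)
proof (induction arbitrary: e rule: derivable.induct)
  case (A4 t x A)
  then show ?case by (simp add: sat_subst)
next
  case (A5 x A B)
  then show ?case by (simp add: sat_fresh_update)
next
  case (Ax A)
  then show ?case by (rule axioms_true)
qed auto

corollary PA_sound: "PA \<turnstile> A \<Longrightarrow> sat e A"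
  using derivable_sound PA_axiom_true by blast

theorem theorem10: "\<not> (\<exists>\<alpha>. PA \<turnstile> \<alpha> \<and> PA \<turnstile> Neg \<alpha>)"
proof
  assume "\<exists>\<alpha>. PA \<turnstile> \<alpha> \<and> PA \<turnstile> Neg \<alpha>"
  then obtain \<alpha> where "PA \<turnstile> \<alpha>" "PA \<turnstile> Neg \<alpha>"
    by blast
  then have "sat (\<lambda>_. 0) \<alpha>" "sat (\<lambda>_. 0) (Neg \<alpha>)"
    by (auto dest: PA_sound simp del: sat.simps)
  then show False
    by simp
qed

end
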